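(* Let $\mathcal{P}$ be a sequential (implicational) proof system with space measure $\mathrm{Sp}(\cdot)$. Suppose $f:\{0,1\}^d\to\{0,1\}$ is a (non-constant) Boolean function such that there exists an $f$-projection that is space-respecting of degree $K$ with respect to $\mathcal{P}$. Then for every unsatisfiable CNF formula $F$ and every semantic $\mathcal{P}$-refutation $\pi_f$ of the substitution formula $F[f]$ there is a resolution refutation $\pi$ of $F$ such that (i) $\pi$ makes at most as many axiom downloads as $\pi_f$, and (ii) $\mathrm{VarSp}(\pi)=O(\mathrm{Sp}(\pi_f)^K)$. In particular, if there is no syntactic resolution refutation of $F$ in variable space $O(s)$ making $O(L)$ axiom downloads, then there is no semantic $\mathcal{P}$-refutation of $F[f]$ in simultaneous length $O(L)$ and $\mathcal{P}$-space $O(s^{1/K})$.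
   Context: Literals: $x^1=x$, $x^0=\neg x$; clauses are disjunctions of literals (sets); $\bot$ is the empty clause; CNF formulas are sets of clauses. For a Boolean function $f$, $f^1=f$, $f^0=\neg f$. For variables $V$, $\mathrm{Vars}^d(V)=\{x_1,\ldots,x_d: x\in V\}$ (fresh), $\vec x=(x_1,\ldots,x_d)$. Substitution formula: with fixed canonical CNFs for $f(\vec x)$ and $\neg f(\vec x)$, set $x[f]=$ CNF of $f(\vec x)$, $(\neg y)[f]=$ CNF of $\neg f(\vec y)$, for a clause $C=a_1\vee\cdots\vee a_k$, $C[f]=\bigwedge_{C_1\in a_1[f]}\cdots\bigwedge_{C_k\in a_k[f]}(C_1\vee\cdots\vee C_k)$, and $F[f]=\bigwedge_{C\in F}C[f]$. Sequential proof system: lines are Boolean functions of a prescribed form; a configuration is a set of lines; a derivation is a sequence $\mathbb{D}_0=\emptyset,\ldots,\mathbb{D}_\tau$, each step an axiom download (adding the encoding of a clause of the formula or a system axiom), an inference (adding a line inferred from lines currently present), or an erasure; a refutation ends with $\bot\in\mathbb{D}_\tau$. Implicational: inferred lines are semantically implied by earlier lines. Semantic derivation: any line semantically implied by the current configuration may be inferred in one step. Length = number of downloads plus inferences; the space of a derivation is the maximum of $\mathrm{Sp}$ over its configurations. Resolution: clauses, with resolution rule ($B\vee x$, $C\vee\neg x$ give $B\vee C$) and weakening; $\mathrm{VarSp}$ of a clause set = number of distinct variables in it, of a refutation = maximum over configurations. "$C$ derivable from $\mathbb{C}$ by weakening": some $C'\subseteq C$ is in $\mathbb{C}$. $f$-projection: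 map $\mathrm{proj}_f$ from sets $\mathbb{D}$ of Boolean functions over $\mathrm{Vars}^d(V)$ of the form used by $\mathcal{P}$ to sets of clauses over $V$ that is complete (if $\mathbb{D}\vDash\bigvee_{x^\nu\in C}f^\nu(\vec x)$ then $C$ is derivable from $\mathrm{proj}_f(\mathbb{D})$ by weakening), nontrivial ($\mathrm{proj}_f(\emptyset)=\emptyset$), monotone (if $\mathbb{D}'\vDash\mathbb{D}$ and $C\in\mathrm{proj}_f(\mathbb{D})$ then $C$ is derivable from $\mathrm{proj}_f(\mathbb{D}')$ by weakening), and incrementally sound (for a clause $A$ over $V$ and $L_A$ the encoding of a clause of $A[f]$, if $C\in\mathrm{proj}_f(\mathbb{D}\cup\{L_A\})$ then for every literal $a\in A\setminus C$, $\neg a\vee C$ is derivable from $\mathrm{proj}_f(\mathbb{D})$ by weakening). Space-respecting of degree $K$: there is a polynomial $Q$ of degree at most $K$ with $Q(\mathrm{Sp}(\mathbb{D}))\ge|\mathrm{Vars}(\mathrm{proj}_f(\mathbb{D}))|$ for every set $\mathbb{D}$ of functions of the form prescribed by $\mathcal{P}$. *)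

theory Defs
  imports "HOL-Computational_Algebra.Polynomial" "HOL-Library.Landau_Symbols"
begin

section \<open>Clauses and CNF formulas\<close>

text \<open>The literal \<open>x\<^sup>\<nu>\<close> is the pair \<open>(x, \<nu>)\<close>, so \<open>(x, True)\<close> is \<open>x\<close> and \<open>(x, False)\<close> is \<open>\<not> x\<close>.\<close>

type_synonym 'v literal = "'v \<times> bool"
type_synonym 'v clause = "'v literal set"

fun neg_lit :: "'v literal \<Rightarrow> 'v literal" where
  "neg_lit (x, \<nu>) = (x, \<not> \<nu>)"

text \<open>
  Clauses are finite and nontrivial, i.e. without complementary literals.  Nontriviality is
  essential for projections: \<open>f(x) \<or> \<not> f(x)\<close> is implied by the empty configuration, so if
  \<open>x \<or> \<not> x\<close> counted as a clause, completeness would contradict \<open>proj {} = {}\<close>.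
\<close>

definition is_clause :: "'v clause \<Rightarrow> bool" where
  "is_clause C \<longleftrightarrow> finite C \<and> (\<forall>a\<in>C. neg_lit a \<notin> C)"

definition is_cnf :: "'v clause set \<Rightarrow> bool" where
  "is_cnf F \<longleftrightarrow> finite F \<and> (\<forall>C\<in>F. is_clause C)"

definition clause_sat :: "('v \<Rightarrow> bool) \<Rightarrow> 'v clause \<Rightarrow> bool" where
  "clause_sat \<alpha> C \<longleftrightarrow> (\<exists>(x, \<nu>)\<in>C. \<alpha> x = \<nu>)"

definition cnf_sat :: "('v \<Rightarrow> bool) \<Rightarrow> 'v clause set \<Rightarrow> bool" where
  "cnf_sat \<alpha> F \<longleftrightarrow> (\<forall>C\<in>F. clause_sat \<alpha> C)"

definition unsatisfiable :: "'v clause set \<Rightarrow> bool" where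
  "unsatisfiable F \<longleftrightarrow> (\<nexists>\<alpha>. cnf_sat \<alpha> F)"

definition vars :: "'v clause set \<Rightarrow> 'v set" where
  "vars \<C> = (\<Union>C\<in>\<C>. fst ` C)"

definition weakening_derivable :: "'v clause set \<Rightarrow> 'v clause \<Rightarrow> bool" where
  "weakening_derivable \<C> C \<longleftrightarrow> (\<exists>C'\<in>\<C>. C' \<subseteq> C)"


section \<open>Substitution formulas\<close>

text \<open>
  The finite type \<open>'d\<close> is the index set of size \<open>d\<close>: \<open>{0,1}\<^sup>d\<close> is \<open>'d \<Rightarrow> bool\<close>, the variables
  \<open>Vars\<^sup>d(V)\<close> are the pairs \<open>(x, i) :: 'v \<times> 'd\<close>, and \<open>V\<close> is the type \<open>'v\<close>.
\<close>

definition fpow :: "('a \<Rightarrow> bool) \<Rightarrow> bool \<Rightarrow> 'a \<Rightarrow> bool" where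
  "fpow f \<nu> u = (if \<nu> then f u else \<not> f u)"

definition nonconstant :: "('a \<Rightarrow> bool) \<Rightarrow> bool" where
  "nonconstant f \<longleftrightarrow> (\<exists>u v. f u \<noteq> f v)"

definition vec :: "('v \<times> 'd \<Rightarrow> bool) \<Rightarrow> 'v \<Rightarrow> 'd \<Rightarrow> bool" where
  "vec \<alpha> x = (\<lambda>i. \<alpha> (x, i))"

text \<open>\<open>cf True\<close> and \<open>cf False\<close> are the CNFs fixed for \<open>f\<close> and \<open>\<not> f\<close>; any choice is admitted.\<close>

definition cnfs_for :: "(('d \<Rightarrow> bool) \<Rightarrow> bool) \<Rightarrow> (bool \<Rightarrow> 'd clause set) \<Rightarrow> bool" where
  "cnfs_for f cf \<longleftrightarrow> (\<forall>\<nu>. is_cnf (cf \<nu>) \<and> (\<forall>u. cnf_sat u (cf \<nu>) \<longleftrightarrow> fpow f \<nu> u))"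

fun lit_subst :: "(bool \<Rightarrow> 'd clause set) \<Rightarrow> 'v literal \<Rightarrow> ('v \<times> 'd) clause set" where
  "lit_subst cf (x, \<nu>) = (\<lambda>B. (\<lambda>(i, \<mu>). ((x, i), \<mu>)) ` B) ` cf \<nu>"

text \<open>The function \<open>g\<close> chooses a clause \<open>C\<^sub>j \<in> a\<^sub>j[f]\<close> for each literal \<open>a\<^sub>j\<close> of \<open>C\<close>.\<close>

definition clause_subst :: "(bool \<Rightarrow> 'd clause set) \<Rightarrow> 'v clause \<Rightarrow> ('v \<times> 'd) clause set" where
  "clause_subst cf C = {\<Union>a\<in>C. g a | g. \<forall>a\<in>C. g a \<in> lit_subst cf a}"

definition cnf_subst :: "(bool \<Rightarrow> 'd clause set) \<Rightarrow> 'v clause set \<Rightarrow> ('v \<times> 'd) clause set" where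
  "cnf_subst cf F = (\<Union>C\<in>F. clause_subst cf C)"


section \<open>Sequential derivations\<close>

text \<open>
  A derivation is given by its list of labelled steps, which determines the sequence of
  configurations starting from the empty one.  The labels make the number of downloads
  well defined even when a line could be either downloaded or inferred.
\<close>

datatype 'l step =
  is_Download: Download 'l | is_Infer: Infer 'l | is_Erase: Erase 'l

primrec next_config :: "'l set \<Rightarrow> 'l step \<Rightarrow> 'l set" where
  "next_config D (Download L) = insert L D"
| "next_config D (Infer L) = insert L D"
| "next_config D (Erase L) = D - {L}"

primrec configs :: "'l set \<Rightarrow> 'l step list \<Rightarrow> 'l set list" where
  "configs D [] = [D]"
| "configs D (s # \<pi>) = D # configs (next_config D s) \<pi>"

primrec legal_step ::
  "'l set \<Rightarrow> ('l set \<Rightarrow> 'l \<Rightarrow> bool) \<Rightarrow> 'l set \<Rightarrow> 'l step \<Rightarrow> bool" where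
  "legal_step Ax infer D (Download L) \<longleftrightarrow> L \<in> Ax"
| "legal_step Ax infer D (Infer L) \<longleftrightarrow> infer D L"
| "legal_step Ax infer D (Erase L) \<longleftrightarrow> L \<in> D"

primrec derivation_from ::
  "'l set \<Rightarrow> ('l set \<Rightarrow> 'l \<Rightarrow> bool) \<Rightarrow> 'l set \<Rightarrow> 'l step list \<Rightarrow> bool" where
  "derivation_from Ax infer D [] \<longleftrightarrow> True"
| "derivation_from Ax infer D (s # \<pi>) \<longleftrightarrow>
     legal_step Ax infer D s \<and> derivation_from Ax infer (next_config D s) \<pi>"

definition refutation ::
  "'l set \<Rightarrow> ('l set \<Rightarrow> 'l \<Rightarrow> bool) \<Rightarrow> 'l \<Rightarrow> 'l step list \<Rightarrow> bool" where
  "refutation Ax infer bottom \<pi> \<longleftrightarrow>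
     derivation_from Ax infer {} \<pi> \<and> bottom \<in> last (configs {} \<pi>)"

definition downloads :: "'l step list \<Rightarrow> nat" where
  "downloads \<pi> = length (filter is_Download \<pi>)"

definition proof_length :: "'l step list \<Rightarrow> nat" where
  "proof_length \<pi> = downloads \<pi> + length (filter is_Infer \<pi>)"

definition proof_space :: "('l set \<Rightarrow> nat) \<Rightarrow> 'l step list \<Rightarrow> nat" where
  "proof_space Sp \<pi> = Max (Sp ` set (configs {} \<pi>))"


section \<open>Resolution\<close>

definition res_infer :: "'v clause set \<Rightarrow> 'v clause \<Rightarrow> bool" where
  "res_infer \<C> C \<longleftrightarrow> is_clause C \<and>
     ((\<exists>x B B'. insert (x, True) B \<in> \<C> \<and> insert (x, False) B' \<in> \<C> \<and> C = B \<union> B') \<or>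
      weakening_derivable \<C> C)"

definition resolution_refutation :: "'v clause set \<Rightarrow> 'v clause step list \<Rightarrow> bool" where
  "resolution_refutation F \<pi> \<longleftrightarrow> refutation F res_infer {} \<pi>"

definition VarSp :: "'v clause step list \<Rightarrow> nat" where
  "VarSp \<pi> = proof_space (\<lambda>\<C>. card (vars \<C>)) \<pi>"


section \<open>Sequential proof systems\<close>

text \<open>
  Lines are syntactic objects of type \<open>'l\<close>, and \<open>denot\<close> gives the Boolean function over the
  variables \<open>'w\<close> that a line denotes; \<open>lines\<close> are those of the prescribed form, \<open>enc\<close>
  encodes clauses as lines, and \<open>rules\<close> are the instances (premises, conclusion) of the
  inference rules.
\<close>

record ('l, 'w) proof_system =
  lines :: "'l set"
  denot :: "'l \<Rightarrow> ('w \<Rightarrow> bool) \<Rightarrow> bool"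
  enc :: "'w clause \<Rightarrow> 'l"
  sys_axioms :: "'l set"
  rules :: "('l set \<times> 'l) set"

definition implies :: "('l, 'w) proof_system \<Rightarrow> 'l set \<Rightarrow> 'l \<Rightarrow> bool" where
  "implies P D L \<longleftrightarrow> (\<forall>\<alpha>. (\<forall>M\<in>D. denot P M \<alpha>) \<longrightarrow> denot P L \<alpha>)"

definition sequential :: "('l, 'w) proof_system \<Rightarrow> bool" where
  "sequential P \<longleftrightarrow>
     (\<forall>C. is_clause C \<longrightarrow>
        enc P C \<in> lines P \<and> (\<forall>\<alpha>. denot P (enc P C) \<alpha> \<longleftrightarrow> clause_sat \<alpha> C)) \<and>
     sys_axioms P \<subseteq> lines P \<and>
     (\<forall>(D, L)\<in>rules P. D \<subseteq> lines P \<and> L \<in> lines P)"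

text \<open>System axioms count as lines inferred from no premises, hence must be valid.\<close>

definition implicational :: "('l, 'w) proof_system \<Rightarrow> bool" where
  "implicational P \<longleftrightarrow>
     (\<forall>(D, L)\<in>rules P. implies P D L) \<and> (\<forall>L\<in>sys_axioms P. implies P {} L)"

definition semantic_refutation ::
  "('l, 'w) proof_system \<Rightarrow> 'w clause set \<Rightarrow> 'l step list \<Rightarrow> bool" where
  "semantic_refutation P F \<pi> \<longleftrightarrow>
     refutation (enc P ` F \<union> sys_axioms P) (\<lambda>D L. L \<in> lines P \<and> implies P D L) (enc P {}) \<pi>"


section \<open>Projections\<close>

text \<open>
  Configurations are finite, so projections are only constrained on finite sets of lines;
  values outside \<open>config P\<close> are irrelevant.
\<close>

definition config :: "('l, 'w) proof_system \<Rightarrow> 'l set \<Rightarrow> bool" where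
  "config P D \<longleftrightarrow> finite D \<and> D \<subseteq> lines P"

definition proj_complete ::
  "('l, 'v \<times> 'd) proof_system \<Rightarrow> (('d \<Rightarrow> bool) \<Rightarrow> bool) \<Rightarrow> ('l set \<Rightarrow> 'v clause set) \<Rightarrow> bool" where
  "proj_complete P f proj \<longleftrightarrow>
     (\<forall>D C. config P D \<longrightarrow> is_clause C \<longrightarrow>
        (\<forall>\<alpha>. (\<forall>L\<in>D. denot P L \<alpha>) \<longrightarrow> (\<exists>(x, \<nu>)\<in>C. fpow f \<nu> (vec \<alpha> x))) \<longrightarrow>
        weakening_derivable (proj D) C)"

definition proj_monotone :: "('l, 'w) proof_system \<Rightarrow> ('l set \<Rightarrow> 'v clause set) \<Rightarrow> bool" where
  "proj_monotone P proj \<longleftrightarrow>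
     (\<forall>D D' C. config P D \<longrightarrow> config P D' \<longrightarrow> (\<forall>L\<in>D. implies P D' L) \<longrightarrow>
        C \<in> proj D \<longrightarrow> weakening_derivable (proj D') C)"

definition proj_incrementally_sound ::
  "('l, 'v \<times> 'd) proof_system \<Rightarrow> (bool \<Rightarrow> 'd clause set) \<Rightarrow> ('l set \<Rightarrow> 'v clause set) \<Rightarrow> bool" where
  "proj_incrementally_sound P cf proj \<longleftrightarrow>
     (\<forall>D A B C a. config P D \<longrightarrow> is_clause A \<longrightarrow> B \<in> clause_subst cf A \<longrightarrow>
        C \<in> proj (D \<union> {enc P B}) \<longrightarrow> a \<in> A - C \<longrightarrow>
        weakening_derivable (proj D) (insert (neg_lit a) C))"

definition f_projection ::
  "('l, 'v \<times> 'd) proof_system \<Rightarrow> (('d \<Rightarrow> bool) \<Rightarrow> bool) \<Rightarrow> (bool \<Rightarrow> 'd clause set) \<Rightarrow>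
   ('l set \<Rightarrow> 'v clause set) \<Rightarrow> bool" where
  "f_projection P f cf proj \<longleftrightarrow>
     (\<forall>D. config P D \<longrightarrow> (\<forall>C\<in>proj D. is_clause C)) \<and>
     proj_complete P f proj \<and>
     proj {} = {} \<and>
     proj_monotone P proj \<and>
     proj_incrementally_sound P cf proj"

text \<open>The finiteness conjunct is part of the bound, since \<open>card\<close> of an infinite set is \<open>0\<close>.\<close>

definition space_respecting ::
  "('l, 'w) proof_system \<Rightarrow> ('l set \<Rightarrow> nat) \<Rightarrow> nat \<Rightarrow> ('l set \<Rightarrow> 'v clause set) \<Rightarrow> bool" where
  "space_respecting P Sp K proj \<longleftrightarrow>
     (\<exists>Q :: real poly. degree Q \<le> K \<and>
        (\<forall>D. config P D \<longrightarrow>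
           finite (vars (proj D)) \<and> real (card (vars (proj D))) \<le> poly Q (real (Sp D))))"

end

theory Submission
  imports Defs
begin

text \<open>
  A semantic refutation with configurations \<open>D\<^sub>t\<close> is simulated by the resolution configurations
  \<open>proj D\<^sub>t\<close>.  Inferences, erasures and system axioms are handled by weakening, because of
  monotonicity.  When a clause of \<open>A[f]\<close> is downloaded, \<open>A\<close> itself is downloaded only if some
  \<open>C \<in> proj D\<^bsub>t+1\<^esub>\<close> is not a weakening of \<open>proj D\<^sub>t\<close>; incremental soundness then provides
  \<open>\<not> a \<or> C\<close> for all \<open>a \<in> A - C\<close>, and resolving these against \<open>A \<or> C\<close> yields \<open>C\<close>.  In that
  case each of the clauses \<open>\<not> a \<or> C\<close> must be a weakening of a clause that really contains \<open>\<not> a\<close>,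
  so all variables of \<open>A\<close> already occur in \<open>proj D\<^sub>t\<close> or in \<open>C\<close>, and the variable space never
  exceeds the sum of those of two consecutive projections.
\<close>

section \<open>Derivation segments\<close>

text \<open>The invariant \<open>S\<close> is imposed on every configuration passed through, both
  ends included, and \<open>k\<close> is only an upper bound on downloads. Segments can thus be
  concatenated by adding bounds, and relaxed afterwards.\<close>

definition segment ::
  "'l set \<Rightarrow> ('l set \<Rightarrow> 'l \<Rightarrow> bool) \<Rightarrow> ('l set \<Rightarrow> bool) \<Rightarrow> nat \<Rightarrow> 'l set \<Rightarrow> 'l set \<Rightarrow> bool" where
  "segment Ax infer S k D D' \<longleftrightarrow>
     (\<exists>\<pi>. derivation_from Ax infer D \<pi> \<and> last (configs D \<pi>) = D' \<and>
          (\<forall>E\<in>set (configs D \<pi>). S E) \<and> downloads \<pi> \<le> k)"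

lemma configs_nonempty [simp]: "configs D \<pi> \<noteq> []"
  by (cases \<pi>) auto

lemma start_in_configs [simp]: "D \<in> set (configs D \<pi>)"
  by (cases \<pi>) auto

lemma segment_refl: "S D \<Longrightarrow> segment Ax infer S k D D"
  unfolding segment_def by (intro exI[of _ "[]"]) (auto simp: downloads_def)

lemma derivation_from_append:
  "derivation_from Ax infer D (\<pi> @ \<pi>') \<longleftrightarrow>
     derivation_from Ax infer D \<pi> \<and> derivation_from Ax infer (last (configs D \<pi>)) \<pi>'"
  by (induction \<pi> arbitrary: D) auto

text \<open>The last configuration of the first part is the first one of the second, so
  \<open>butlast\<close> keeps it from being listed twice.\<close>

lemma configs_append:
  "configs D (\<pi> @ \<pi>') = butlast (configs D \<pi>) @ configs (last (configs D \<pi>)) \<pi>'"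
  by (induction \<pi> arbitrary: D) auto

lemma segment_trans:
  assumes "segment Ax infer S k D D'" and "segment Ax infer S l D' D''"
  shows "segment Ax infer S (k + l) D D''"
proof -
  obtain \<pi> \<pi>' where
    "derivation_from Ax infer D \<pi>" "last (configs D \<pi>) = D'"
    "\<forall>E\<in>set (configs D \<pi>). S E" "downloads \<pi> \<le> k"
    "derivation_from Ax infer D' \<pi>'" "last (configs D' \<pi>') = D''"
    "\<forall>E\<in>set (configs D' \<pi>'). S E" "downloads \<pi>' \<le> l"
    using assms unfolding segment_def by blast
  then show ?thesis
    unfolding segment_def
    by (intro exI[of _ "\<pi> @ \<pi>'"])
      (auto simp: derivation_from_append configs_append downloads_def dest: in_set_butlastD)
qed

lemma segment_trans0:
  "segment Ax infer S k D D' \<Longrightarrow> segment Ax infer S 0 D' D'' \<Longrightarrow> segment Ax infer S k D D''"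
  using segment_trans[of Ax infer S k D D' 0 D''] by simp

lemma segment_mono:
  assumes "segment Ax infer S k D D'" and "k \<le> l" and "\<And>E. S E \<Longrightarrow> T E"
  shows "segment Ax infer T l D D'"
proof -
  obtain \<pi> where "derivation_from Ax infer D \<pi>" "last (configs D \<pi>) = D'"
    "\<forall>E\<in>set (configs D \<pi>). S E" "downloads \<pi> \<le> k"
    using assms(1) unfolding segment_def by blast
  then show ?thesis
    using assms(2,3) unfolding segment_def by (intro exI[of _ \<pi>]) auto
qed

lemma segment_infer:
  "infer D L \<Longrightarrow> S D \<Longrightarrow> S (insert L D) \<Longrightarrow> segment Ax infer S k D (insert L D)"
  unfolding segment_def by (intro exI[of _ "[Infer L]"]) (auto simp: downloads_def)

lemma segment_download:
  "L \<in> Ax \<Longrightarrow> S D \<Longrightarrow> S (insert L D) \<Longrightarrow> segment Ax infer S 1 D (insert L D)"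
  unfolding segment_def by (intro exI[of _ "[Download L]"]) (auto simp: downloads_def)

lemma segment_erase:
  "L \<in> D \<Longrightarrow> S D \<Longrightarrow> S (D - {L}) \<Longrightarrow> segment Ax infer S 0 D (D - {L})"
  unfolding segment_def by (intro exI[of _ "[Erase L]"]) (auto simp: downloads_def)

text \<open>Elements are erased one at a time, so all intermediate configurations are subsets of
  \<open>D\<close>; hence the demand on \<open>S\<close> for each subset.\<close>

lemma segment_erase_set:
  assumes "finite X" and "X \<subseteq> D" and "\<And>E. E \<subseteq> D \<Longrightarrow> S E"
  shows "segment Ax infer S 0 D (D - X)"
  using assms
proof (induction X rule: finite_induct)
  case empty
  then show ?case by (simp add: segment_refl)
next
  case (insert L X)
  have "segment Ax infer S 0 D (D - X)"
    using insert.IH insert.prems by simp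
  moreover have "segment Ax infer S 0 (D - X) (D - X - {L})"
  proof (rule segment_erase)
    show "L \<in> D - X"
      using insert.hyps insert.prems(1) by simp
  qed (rule insert.prems(2), blast)+
  moreover have "D - X - {L} = D - insert L X" by blast
  ultimately show ?case
    using segment_trans0 by metis
qed


section \<open>Resolution within a fixed set of variables\<close>

text \<open>Containment in a fixed \<open>V\<close> is easier to maintain than a cardinality bound:
  it passes to subsets and is checked clause by clause.\<close>

abbreviation res_segment ::
  "'v clause set \<Rightarrow> 'v set \<Rightarrow> nat \<Rightarrow> 'v clause set \<Rightarrow> 'v clause set \<Rightarrow> bool" where
  "res_segment F V \<equiv> segment F res_infer (\<lambda>E. vars E \<subseteq> V)"

lemma vars_insert [simp]: "vars (insert C D) = fst ` C \<union> vars D"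
  by (auto simp: vars_def)

lemma vars_mono: "D \<subseteq> E \<Longrightarrow> vars D \<subseteq> vars E"
  by (auto simp: vars_def)

text \<open>Finitely many variables admit only finitely many sets of literals. This lets whole
  projections be derived and erased clause by clause.\<close>

lemma finite_if_finite_vars:
  assumes "finite (vars D)"
  shows "finite D"
proof (rule finite_subset)
  show "D \<subseteq> Pow (vars D \<times> UNIV)"
    by (force simp: vars_def)
qed (use assms in simp)

lemma fst_neg_lit [simp]: "fst (neg_lit a) = fst a"
  by (cases a) auto

lemma neg_lit_neg_lit [simp]: "neg_lit (neg_lit a) = a"
  by (cases a) auto

lemma neg_lit_neq [simp]: "neg_lit a \<noteq> a"
  by (cases a) auto

lemma is_clause_insert_neg_lit:
  assumes "is_clause C" and "a \<notin> C"
  shows "is_clause (insert (neg_lit a) C)"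
proof -
  have "neg_lit b \<noteq> neg_lit a" if "b \<in> C" for b
    using that assms(2) by (metis neg_lit_neg_lit)
  then show ?thesis
    using assms by (auto simp: is_clause_def dest: sym)
qed

lemma weakening_derivable_mono:
  "weakening_derivable D C \<Longrightarrow> D \<subseteq> E \<Longrightarrow> weakening_derivable E C"
  by (auto simp: weakening_derivable_def)

lemma res_infer_weakening: "is_clause C \<Longrightarrow> weakening_derivable D C \<Longrightarrow> res_infer D C"
  by (simp add: res_infer_def)

lemma res_segment_infer:
  "res_infer D C \<Longrightarrow> fst ` C \<subseteq> V \<Longrightarrow> vars D \<subseteq> V \<Longrightarrow> res_segment F V 0 D (insert C D)"
  by (rule segment_infer) (simp_all only: vars_insert Un_subset_iff simp_thms)

text \<open>A form of the resolution rule that is independent of the sign of \<open>a\<close>; for a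
  negative \<open>a\<close> the two premises swap roles.\<close>

lemma res_infer_resolve:
  assumes "insert a B \<in> D" and "insert (neg_lit a) B' \<in> D" and "is_clause (B \<union> B')"
  shows "res_infer D (B \<union> B')"
proof (cases a)
  case (Pair x \<nu>)
  then show ?thesis
    using assms by (cases \<nu>) (auto simp: res_infer_def Un_commute)
qed

text \<open>The literals of \<open>U\<close> are removed one by one: resolving
  \<open>C \<union> insert a U\<close> with \<not> a \<or> C leaves \<open>C \<union> U\<close>.
  Nothing is erased, so the derivability hypotheses survive, and no variable outside
  \<open>V\<close> enters.\<close>

lemma resolve_away:
  assumes "finite U" and "C \<union> U \<in> D" and "is_clause (C \<union> U)"
    and "\<And>a. a \<in> U - C \<Longrightarrow> weakening_derivable D (insert (neg_lit a) C)"
    and "vars D \<subseteq> V"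
  shows "\<exists>E. res_segment F V 0 D E \<and> D \<subseteq> E \<and> C \<in> E \<and> vars E \<subseteq> V"
  using assms
proof (induction U arbitrary: D rule: finite_induct)
  case empty
  then show ?case
    by (intro exI[of _ D]) (auto intro: segment_refl)
next
  case (insert a U)
  have cl: "is_clause (C \<union> U)" "is_clause C"
    using insert.prems(2) by (auto simp: is_clause_def)
  have sub: "fst ` (C \<union> insert a U) \<subseteq> V"
    using insert.prems(1,4) by (auto simp: vars_def)
  show ?case
  proof (cases "a \<in> C")
    case True
    then have "C \<union> insert a U = C \<union> U" by blast
    then show ?thesis
      using insert.IH[of D] insert.prems cl by auto
  next
    case False
    let ?N = "insert (neg_lit a) C"
    define D1 where "D1 = insert ?N D"
    define D2 where "D2 = insert (C \<union> U) D1"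
    have "res_infer D ?N"
      using False cl insert.prems(3)[of a]
      by (intro res_infer_weakening is_clause_insert_neg_lit) auto
    then have 1: "res_segment F V 0 D D1"
      using sub insert.prems(4) unfolding D1_def by (intro res_segment_infer) auto
    \<comment> \<open>The side clauses are \<open>C \<union> U\<close> and \<open>C\<close>, so the
      resolvent collapses to \<open>C \<union> U\<close>.\<close>
    have "insert a (C \<union> U) \<in> D1" "?N \<in> D1" "is_clause ((C \<union> U) \<union> C)"
      using insert.prems(1) cl by (auto simp: D1_def Un_ac)
    from res_infer_resolve[OF this] have "res_infer D1 (C \<union> U)"
      by (simp add: Un_ac)
    then have 2: "res_segment F V 0 D1 D2"
      using sub insert.prems(4) unfolding D2_def D1_def by (intro res_segment_infer) auto
    have "vars D2 \<subseteq> V" "D \<subseteq> D2" "C \<union> U \<in> D2"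
      using sub insert.prems(4) by (auto simp: D1_def D2_def)
    moreover have "weakening_derivable D2 (insert (neg_lit b) C)" if "b \<in> U - C" for b
      using insert.prems(3)[of b] that \<open>D \<subseteq> D2\<close> weakening_derivable_mono by blast
    ultimately obtain E where E: "res_segment F V 0 D2 E" "D2 \<subseteq> E" "C \<in> E" "vars E \<subseteq> V"
      using insert.IH[of D2] cl by blast
    have "res_segment F V 0 D E"
      using segment_trans0[OF segment_trans0[OF 1 2] E(1)] .
    then show ?thesis
      using E \<open>D \<subseteq> D2\<close> by blast
  qed
qed

text \<open>The hypothesis \<open>step\<close> ranges over all supersets of \<open>D\<close> because
  targets derived earlier stay in memory while the next one is derived.\<close>

lemma derive_all:
  assumes "finite R'" and "vars D \<subseteq> V"
    and step: "\<And>C E. C \<in> R' \<Longrightarrow> D \<subseteq> E \<Longrightarrow> vars E \<subseteq> V \<Longrightarrow>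
      \<exists>E'. res_segment F V 0 E E' \<and> E \<subseteq> E' \<and> C \<in> E' \<and> vars E' \<subseteq> V"
  shows "\<exists>E. res_segment F V 0 D E \<and> D \<subseteq> E \<and> R' \<subseteq> E \<and> vars E \<subseteq> V"
  using assms(1) step
proof (induction R' rule: finite_induct)
  case empty
  then show ?case
    using assms(2) by (intro exI[of _ D]) (auto intro: segment_refl)
next
  case (insert C R')
  obtain E where E: "res_segment F V 0 D E" "D \<subseteq> E" "R' \<subseteq> E" "vars E \<subseteq> V"
    using insert.IH insert.prems by (metis insertI2)
  then obtain E' where E': "res_segment F V 0 E E'" "E \<subseteq> E'" "C \<in> E'" "vars E' \<subseteq> V"
    using insert.prems[of C E] by blast
  show ?case
    using segment_trans0[OF E(1) E'(1)] E E' by blast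
qed

text \<open>All clauses are kept until every target is present, and only then is the rest erased.
  This costs no variables, since \<open>V\<close> covers the intermediate clauses too.\<close>

lemma derive_all_and_erase:
  assumes "finite V" and "vars D \<subseteq> V" and "vars R' \<subseteq> V"
    and "\<And>C E. C \<in> R' \<Longrightarrow> D \<subseteq> E \<Longrightarrow> vars E \<subseteq> V \<Longrightarrow>
      \<exists>E'. res_segment F V 0 E E' \<and> E \<subseteq> E' \<and> C \<in> E' \<and> vars E' \<subseteq> V"
  shows "res_segment F V 0 D R'"
proof -
  have "finite R'"
    using assms(1,3) finite_if_finite_vars finite_subset by metis
  then obtain E where E: "res_segment F V 0 D E" "R' \<subseteq> E" "vars E \<subseteq> V"
    using derive_all[of R' D V F] assms(2,4) by blast
  have "finite E"
    using assms(1) E(3) finite_if_finite_vars finite_subset by metis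
  then have "res_segment F V 0 E (E - (E - R'))"
  proof (intro segment_erase_set)
    show "vars E' \<subseteq> V" if "E' \<subseteq> E" for E'
      using vars_mono[OF that] E(3) by simp
  qed auto
  moreover have "E - (E - R') = R'"
    using E(2) by blast
  ultimately show ?thesis
    using segment_trans0[OF E(1)] by simp
qed

section \<open>Passing from one projected clause set to the next\<close>

lemma clause_vars_subset: "C \<in> R \<Longrightarrow> vars R \<subseteq> V \<Longrightarrow> fst ` C \<subseteq> V"
  by (auto simp: vars_def)

lemma res_segment_weakening:
  assumes "finite V" and "vars R \<subseteq> V" and "vars R' \<subseteq> V"
    and "\<And>C. C \<in> R' \<Longrightarrow> is_clause C" and "\<And>C. C \<in> R' \<Longrightarrow> weakening_derivable R C"
  shows "res_segment F V 0 R R'"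
proof (rule derive_all_and_erase[OF assms(1-3)])
  fix C E assume "C \<in> R'" "R \<subseteq> E" "vars E \<subseteq> V"
  moreover have "fst ` C \<subseteq> V"
    using clause_vars_subset[OF \<open>C \<in> R'\<close> assms(3)] .
  moreover have "res_infer E C"
    using res_infer_weakening assms(4,5) weakening_derivable_mono \<open>C \<in> R'\<close> \<open>R \<subseteq> E\<close> by blast
  ultimately have "res_segment F V 0 E (insert C E)" "vars (insert C E) \<subseteq> V"
    using res_segment_infer by auto
  then show "\<exists>E'. res_segment F V 0 E E' \<and> E \<subseteq> E' \<and> C \<in> E' \<and> vars E' \<subseteq> V"
    by blast
qed

text \<open>The hypothesis \<open>sound\<close> is what incremental soundness gives for the download
  of an encoded clause of A[f]. The set \<open>V\<close> need not contain the variables of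
  \<open>A\<close> in advance.\<close>

lemma res_segment_axiom:
  assumes fin: "finite V" and R: "vars R \<subseteq> V" and R': "vars R' \<subseteq> V"
    and cl: "\<And>C. C \<in> R' \<Longrightarrow> is_clause C"
    and A: "A \<in> F" "is_clause A"
    and sound: "\<And>C a. C \<in> R' \<Longrightarrow> a \<in> A - C \<Longrightarrow> weakening_derivable R (insert (neg_lit a) C)"
  shows "res_segment F V 1 R R'"
proof (cases "\<forall>C\<in>R'. weakening_derivable R C")
  \<comment> \<open>\<open>A\<close> is not downloaded here, as its variables may lie outside
    \<open>V\<close>.\<close>
  case True
  then show ?thesis
    using segment_mono[OF res_segment_weakening[OF fin R R' cl], where l = 1 and T = "\<lambda>E. vars E \<subseteq> V"]
    by auto
next
  case False
  then obtain C\<^sub>0 where C\<^sub>0: "C\<^sub>0 \<in> R'" "\<not> weakening_derivable R C\<^sub>0"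
    by blast
  have "fst a \<in> V" if a: "a \<in> A" for a
  proof (cases "a \<in> C\<^sub>0")
    case True
    then show ?thesis
      using clause_vars_subset[OF C\<^sub>0(1) R'] by auto
  next
    case False
    then obtain B where B: "B \<in> R" "B \<subseteq> insert (neg_lit a) C\<^sub>0"
      using sound[OF C\<^sub>0(1), of a] a by (auto simp: weakening_derivable_def)
    \<comment> \<open>Otherwise \<open>B \<subseteq> C\<^sub>0\<close>, and \<open>C\<^sub>0\<close>
      would be a weakening of \<open>R\<close>.\<close>
    then have "neg_lit a \<in> B"
      using C\<^sub>0(2) by (auto simp: weakening_derivable_def)
    then have "fst (neg_lit a) \<in> V"
      using clause_vars_subset[OF B(1) R] by blast
    then show ?thesis by simp
  qed
  then have varsA: "fst ` A \<subseteq> V" by auto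
  have "res_segment F V 1 R (insert A R)"
    using A R varsA by (intro segment_download) auto
  moreover have "res_segment F V 0 (insert A R) R'"
  proof (rule derive_all_and_erase[OF fin _ R'])
    show "vars (insert A R) \<subseteq> V"
      using R varsA by simp
    fix C E assume C: "C \<in> R'" and E: "insert A R \<subseteq> E" "vars E \<subseteq> V"
    have varsC: "fst ` C \<subseteq> V"
      using clause_vars_subset[OF C R'] .
    have wk: "weakening_derivable E (insert (neg_lit a) C)" if "a \<in> A - C" for a
      using sound[OF C that] E(1) weakening_derivable_mono by blast
    show "\<exists>E'. res_segment F V 0 E E' \<and> E \<subseteq> E' \<and> C \<in> E' \<and> vars E' \<subseteq> V"
    proof (cases "weakening_derivable E C")
      case True
      then have "res_segment F V 0 E (insert C E)"
        using C E varsC cl by (intro res_segment_infer res_infer_weakening) auto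
      then show ?thesis
        using E varsC by (intro exI[of _ "insert C E"]) auto
    next
      case False
      \<comment> \<open>Resolution may only derive nontrivial clauses, so
        \<open>C \<union> A\<close> must have no complementary pair. If \<not> a were in
        \<open>C\<close>, then \<not> a \<or> C would be \<open>C\<close> itself, already available
        by weakening.\<close>
      have "neg_lit a \<notin> C" if "a \<in> A" for a
      proof
        assume "neg_lit a \<in> C"
        then have "a \<in> A - C" "insert (neg_lit a) C = C"
          using that cl[OF C] by (auto simp: is_clause_def)
        then show False
          using wk[of a] False by simp
      qed
      then have clAC: "is_clause (C \<union> A)"
        using A(2) cl[OF C] unfolding is_clause_def by (metis Un_iff finite_Un neg_lit_neg_lit)
      let ?E = "insert (C \<union> A) E"
      have "weakening_derivable E (C \<union> A)"
        using E(1) by (auto simp: weakening_derivable_def)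
      then have 1: "res_segment F V 0 E ?E"
        using clAC E varsA varsC by (intro res_segment_infer res_infer_weakening) (auto simp: image_Un)
      have "\<exists>E'. res_segment F V 0 ?E E' \<and> ?E \<subseteq> E' \<and> C \<in> E' \<and> vars E' \<subseteq> V"
      proof (rule resolve_away[of A])
        show "finite A" using A(2) by (simp add: is_clause_def)
        show "weakening_derivable ?E (insert (neg_lit a) C)" if "a \<in> A - C" for a
          using wk[OF that] weakening_derivable_mono by blast
      qed (use clAC E varsA varsC in auto)
      then show ?thesis
        using segment_trans0[OF 1] by blast
    qed
  qed
  ultimately show ?thesis
    by (rule segment_trans0)
qed


section \<open>Projecting semantic refutations\<close>

text \<open>Encodings are specified for nontrivial clauses only. Each literal of \<open>B\<close>
  records the variable of \<open>A\<close> it stems from; as \<open>A\<close> is nontrivial,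
  complementary literals of \<open>B\<close> would stem from one literal of \<open>A\<close>, hence
  from one clause of the CNF fixed for f or its negation, which is nontrivial.\<close>

lemma is_clause_clause_subst:
  assumes "cnfs_for f cf" and A: "is_clause A" and B: "B \<in> clause_subst cf A"
  shows "is_clause B"
proof -
  obtain g where B_eq: "B = (\<Union>a\<in>A. g a)" and g: "\<forall>a\<in>A. g a \<in> lit_subst cf a"
    using B unfolding clause_subst_def by blast
  have rename: "\<exists>G. is_clause G \<and> g (x, \<nu>) = (\<lambda>(i, \<mu>). ((x, i), \<mu>)) ` G"
    if "(x, \<nu>) \<in> A" for x \<nu>
    using g that assms(1) by (fastforce simp: cnfs_for_def is_cnf_def)
  have "finite (g a)" if "a \<in> A" for a
    using rename[of "fst a" "snd a"] that by (auto simp: is_clause_def)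
  then have "finite B"
    using A by (auto simp: B_eq is_clause_def)
  moreover have "neg_lit b \<notin> B" if b_in: "b \<in> B" for b
  proof
    assume "neg_lit b \<in> B"
    obtain x i \<mu> where b: "b = ((x, i), \<mu>)" by (metis surj_pair)
    obtain y \<nu> where y: "(y, \<nu>) \<in> A" "b \<in> g (y, \<nu>)"
      using b_in unfolding B_eq by auto
    obtain z \<kappa> where z: "(z, \<kappa>) \<in> A" "neg_lit b \<in> g (z, \<kappa>)"
      using \<open>neg_lit b \<in> B\<close> unfolding B_eq by auto
    obtain G where G: "is_clause G" "g (y, \<nu>) = (\<lambda>(i, \<mu>). ((y, i), \<mu>)) ` G"
      using rename y by blast
    obtain H where H: "g (z, \<kappa>) = (\<lambda>(i, \<mu>). ((z, i), \<mu>)) ` H"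
      using rename z by blast
    have "y = x" "z = x" "(i, \<mu>) \<in> G"
      using y z G H b by auto
    moreover have "\<kappa> = \<nu>"
      using A y(1) z(1) \<open>y = x\<close> \<open>z = x\<close> unfolding is_clause_def
      by (cases \<nu>; cases \<kappa>) force+
    ultimately have "(i, \<not> \<mu>) \<in> G"
      using z G b by auto
    then show False
      using G(1) \<open>(i, \<mu>) \<in> G\<close> unfolding is_clause_def by (metis neg_lit.simps)
  qed
  ultimately show ?thesis
    by (simp add: is_clause_def)
qed

lemma implies_member: "L \<in> D \<Longrightarrow> implies P D L"
  by (simp add: implies_def)

text \<open>Except when an encoded clause is downloaded, the new configuration is implied by the old
  one, so only that case can require a download from \<open>F\<close>.\<close>

lemma res_segment_projection_step:
  fixes P :: "('l, 'v \<times> 'd) proof_system"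
  assumes seq: "sequential P" and imp: "implicational P" and cf: "cnfs_for f cf"
    and proj: "f_projection P f cf proj" and F: "is_cnf F"
    and fin: "\<And>D. config P D \<Longrightarrow> finite (vars (proj D))"
    and D: "config P D"
    and legal: "legal_step (enc P ` cnf_subst cf F \<union> sys_axioms P)
                  (\<lambda>D L. L \<in> lines P \<and> implies P D L) D s"
  shows "config P (next_config D s) \<and>
         res_segment F (vars (proj D) \<union> vars (proj (next_config D s)))
           (if is_Download s then 1 else 0) (proj D) (proj (next_config D s))"
proof -
  let ?D' = "next_config D s"
  let ?V = "vars (proj D) \<union> vars (proj ?D')"
  have cl: "is_clause C" if "config P E" "C \<in> proj E" for E C
    using proj that by (simp add: f_projection_def)
  have by_weakening: ?thesis if D': "config P ?D'" and "\<forall>L\<in>?D'. implies P D L"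
  proof -
    \<comment> \<open>Monotonicity is applied with the old configuration as the stronger
      one.\<close>
    have "weakening_derivable (proj D) C" if "C \<in> proj ?D'" for C
      using proj D D' \<open>\<forall>L\<in>?D'. implies P D L\<close> that
      unfolding f_projection_def proj_monotone_def by blast
    then have "res_segment F ?V 0 (proj D) (proj ?D')"
      using fin D D' cl by (intro res_segment_weakening) auto
    \<comment> \<open>The bound 0 is relaxed because the download of a system axiom counts on the
      semantic side although it costs nothing here.\<close>
    then show ?thesis
      using D' segment_mono[where l = "if is_Download s then 1 else 0"] by fastforce
  qed
  show ?thesis
  proof (cases s)
    case (Download L)
    then consider (sys) "L \<in> sys_axioms P" | (cl) "L \<in> enc P ` cnf_subst cf F"
      using legal by auto
    then show ?thesis
    proof cases
      case sys
      \<comment> \<open>A system axiom is valid, so it is treated like an inference.\<close>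
      then have "implies P D L" "L \<in> lines P"
        using seq imp by (auto simp: implicational_def implies_def sequential_def)
      then show ?thesis
        using by_weakening D Download by (auto simp: config_def implies_member)
    next
      case cl
      then obtain A B where A: "A \<in> F" "B \<in> clause_subst cf A" "L = enc P B"
        by (auto simp: cnf_subst_def)
      have clA: "is_clause A"
        using F A by (simp add: is_cnf_def)
      have "is_clause B"
        using is_clause_clause_subst[OF cf clA A(2)] .
      then have D': "config P ?D'"
        using seq D Download A by (auto simp: config_def sequential_def)
      have "?D' = D \<union> {enc P B}"
        using Download A by simp
      then have "weakening_derivable (proj D) (insert (neg_lit a) C)"
        if "C \<in> proj ?D'" "a \<in> A - C" for a C
        using proj D clA A(2) that unfolding f_projection_def proj_incrementally_sound_def by metis
      then have "res_segment F ?V 1 (proj D) (proj ?D')"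
        using fin D D' A(1) clA \<open>\<And>E C. config P E \<Longrightarrow> C \<in> proj E \<Longrightarrow> is_clause C\<close>
        by (intro res_segment_axiom[of _ _ _ A]) auto
      then show ?thesis
        using D' Download by simp
    qed
  next
    case (Infer L)
    then show ?thesis
      using by_weakening D legal by (auto simp: config_def implies_member)
  next
    case (Erase L)
    then show ?thesis
      using by_weakening D legal by (auto simp: config_def implies_member)
  qed
qed

section \<open>From single steps to whole refutations\<close>

text \<open>Between two consecutive projections, each with at most \<open>m\<close> variables, only
  the variables of these two occur; hence \<open>2 * m\<close>. The bound may presuppose
  \<open>config P E\<close> because the induction establishes it for each configuration
  reached.\<close>

lemma segment_projection:
  fixes P :: "('l, 'v \<times> 'd) proof_system"
  assumes "sequential P" and "implicational P" and "cnfs_for f cf"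
    and "f_projection P f cf proj" and "is_cnf F"
    and fin: "\<And>D. config P D \<Longrightarrow> finite (vars (proj D))"
    and "config P D"
    and "derivation_from (enc P ` cnf_subst cf F \<union> sys_axioms P)
                  (\<lambda>D L. L \<in> lines P \<and> implies P D L) D \<pi>"
    and "\<And>E. E \<in> set (configs D \<pi>) \<Longrightarrow> config P E \<Longrightarrow> card (vars (proj E)) \<le> m"
  shows "config P (last (configs D \<pi>)) \<and>
         segment F res_infer (\<lambda>E. card (vars E) \<le> 2 * m) (downloads \<pi>)
           (proj D) (proj (last (configs D \<pi>)))"
  using assms(7-)
proof (induction \<pi> arbitrary: D)
  case Nil
  then show ?case
    by (force intro!: segment_refl)
next
  case (Cons s \<pi>)
  let ?D' = "next_config D s"
  let ?S = "\<lambda>E :: 'v clause set. card (vars E) \<le> 2 * m"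
  let ?V = "vars (proj D) \<union> vars (proj ?D')"
  have D': "config P ?D'"
    and step: "res_segment F ?V (if is_Download s then 1 else 0) (proj D) (proj ?D')"
    using res_segment_projection_step[OF assms(1-5) fin Cons.prems(1), of s] Cons.prems(2) by auto
  have rest: "config P (last (configs ?D' \<pi>))"
    "segment F res_infer ?S (downloads \<pi>) (proj ?D') (proj (last (configs ?D' \<pi>)))"
    using Cons.IH[OF D'] Cons.prems by auto
  have "card (vars (proj D)) \<le> m" "card (vars (proj ?D')) \<le> m"
    using Cons.prems D' by auto
  then have "card ?V \<le> 2 * m"
    using card_Un_le[of "vars (proj D)" "vars (proj ?D')"] by linarith
  moreover have "finite ?V"
    using fin D' Cons.prems(1) by blast
  \<comment> \<open>Containment in \<open>?V\<close> becomes a cardinality bound; \<open>?V\<close>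
    must be finite for \<open>card\<close> to be monotone.\<close>
  ultimately have "?S E" if "vars E \<subseteq> ?V" for E
    using card_mono[OF _ that] by linarith
  then have "segment F res_infer ?S (if is_Download s then 1 else 0) (proj D) (proj ?D')"
    using segment_mono[OF step order_refl, of ?S] by blast
  from segment_trans[OF this rest(2)] rest(1) show ?case
    by (auto simp: downloads_def split: if_splits)
qed

lemma resolution_refutation_of_projection:
  fixes P :: "('l, 'v \<times> 'd) proof_system"
  assumes seq: "sequential P" and imp: "implicational P" and cf: "cnfs_for f cf"
    and proj: "f_projection P f cf proj" and F: "is_cnf F"
    and fin: "\<And>D. config P D \<Longrightarrow> finite (vars (proj D))"
    and ref: "semantic_refutation P (cnf_subst cf F) \<pi>\<^sub>f"
    and bound: "\<And>E. E \<in> set (configs {} \<pi>\<^sub>f) \<Longrightarrow> config P E \<Longrightarrow> card (vars (proj E)) \<le> m"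
  shows "\<exists>\<pi>. resolution_refutation F \<pi> \<and> downloads \<pi> \<le> downloads \<pi>\<^sub>f \<and> VarSp \<pi> \<le> 2 * m"
proof -
  let ?D = "last (configs {} \<pi>\<^sub>f)"
  have "config P {}" by (simp add: config_def)
  then have D: "config P ?D"
    and seg: "segment F res_infer (\<lambda>E. card (vars E) \<le> 2 * m) (downloads \<pi>\<^sub>f) (proj {}) (proj ?D)"
    using segment_projection[OF seq imp cf proj F fin, of "{}" \<pi>\<^sub>f m] ref bound
    by (auto simp: semantic_refutation_def refutation_def)
  have "enc P {} \<in> ?D"
    using ref by (simp add: semantic_refutation_def refutation_def)
  moreover have "\<not> denot P (enc P {}) \<alpha>" for \<alpha>
    using seq by (auto simp: sequential_def is_clause_def clause_sat_def)
  \<comment> \<open>The final configuration is unsatisfiable, so completeness applies to the empty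
    clause.\<close>
  ultimately have "\<not> (\<forall>L\<in>?D. denot P L \<alpha>)" for \<alpha>
    by blast
  moreover have "is_clause {}"
    by (simp add: is_clause_def)
  ultimately have "weakening_derivable (proj ?D) {}"
    using proj D unfolding f_projection_def proj_complete_def by blast
  then have "{} \<in> proj ?D"
    by (auto simp: weakening_derivable_def)
  \<comment> \<open>Nontriviality makes the simulation start from the empty configuration.\<close>
  moreover have "proj {} = {}"
    using proj by (simp add: f_projection_def)
  ultimately show ?thesis
    using seg unfolding segment_def resolution_refutation_def refutation_def VarSp_def proof_space_def
    by fastforce
qed

section \<open>Growth of the space polynomial and asymptotic form\<close>

text \<open>Absolute values make each monomial monotone, and \<open>1 \<le> y\<close> allows raising
  its exponent to \<open>K\<close>. The separate \<open>y\<close> is needed since the space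
  \<open>x\<close> of a single configuration may be 0.\<close>

lemma poly_le_sum_abs_coeff_mult_power:
  fixes Q :: "real poly"
  assumes "degree Q \<le> K" and "0 \<le> x" and "x \<le> y" and "1 \<le> y"
  shows "poly Q x \<le> (\<Sum>i\<le>degree Q. \<bar>coeff Q i\<bar>) * y ^ K"
  unfolding poly_altdef sum_distrib_right
proof (rule sum_mono)
  fix i assume "i \<in> {..degree Q}"
  then have "x ^ i \<le> y ^ K"
    using assms power_mono[of x y i] power_increasing[of i K y] by simp
  then have "\<bar>coeff Q i\<bar> * x ^ i \<le> \<bar>coeff Q i\<bar> * y ^ K"
    by (intro mult_left_mono) auto
  moreover have "coeff Q i * x ^ i \<le> \<bar>coeff Q i\<bar> * x ^ i"
    using assms(2) by (intro mult_right_mono) auto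
  ultimately show "coeff Q i * x ^ i \<le> \<bar>coeff Q i\<bar> * y ^ K" by linarith
qed

text \<open>The constant depends on \<open>Q\<close> alone, so it is the same for all formulas and
  refutations. \<open>max 1\<close> covers space 0, where \<open>Q\<close> may still be
  positive.\<close>

lemma space_bounded_resolution_refutation:
  fixes P :: "('l, 'v \<times> 'd) proof_system"
  assumes "sequential P" and "implicational P" and "cnfs_for f cf"
    and "f_projection P f cf proj" and "space_respecting P Sp K proj"
  shows "\<exists>c :: real. \<forall>F. is_cnf F \<longrightarrow>
           (\<forall>\<pi>\<^sub>f. semantic_refutation P (cnf_subst cf F) \<pi>\<^sub>f \<longrightarrow>
              (\<exists>\<pi>. resolution_refutation F \<pi> \<and> downloads \<pi> \<le> downloads \<pi>\<^sub>f \<and>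
                   real (VarSp \<pi>) \<le> c * real (max 1 (proof_space Sp \<pi>\<^sub>f)) ^ K))"
proof -
  obtain Q :: "real poly" where Q: "degree Q \<le> K"
    and fin: "\<And>D. config P D \<Longrightarrow> finite (vars (proj D))"
    and space: "\<And>D. config P D \<Longrightarrow> real (card (vars (proj D))) \<le> poly Q (real (Sp D))"
    using assms(5) unfolding space_respecting_def by blast
  define c where "c = (\<Sum>i\<le>degree Q. \<bar>coeff Q i\<bar>)"
  have "\<exists>\<pi>. resolution_refutation F \<pi> \<and> downloads \<pi> \<le> downloads \<pi>\<^sub>f \<and>
            real (VarSp \<pi>) \<le> (2 * c) * real (max 1 (proof_space Sp \<pi>\<^sub>f)) ^ K"
    if F: "is_cnf F" and ref: "semantic_refutation P (cnf_subst cf F) \<pi>\<^sub>f" for F \<pi>\<^sub>f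
  proof -
    let ?b = "c * real (max 1 (proof_space Sp \<pi>\<^sub>f)) ^ K"
    have "0 \<le> c" unfolding c_def by (intro sum_nonneg) auto
    then have "0 \<le> ?b" by simp
    \<comment> \<open>The floor turns the real bound into the natural number \<open>m\<close> of the
      simulation.\<close>
    have "card (vars (proj E)) \<le> nat \<lfloor>?b\<rfloor>" if "E \<in> set (configs {} \<pi>\<^sub>f)" "config P E" for E
    proof -
      have "Sp E \<le> proof_space Sp \<pi>\<^sub>f"
        using that(1) by (simp add: proof_space_def)
      then have "poly Q (real (Sp E)) \<le> ?b"
        unfolding c_def using Q by (intro poly_le_sum_abs_coeff_mult_power) auto
      then show ?thesis
        using space[OF that(2)] by (intro le_nat_floor) linarith
    qed
    then obtain \<pi> where \<pi>: "resolution_refutation F \<pi>" "downloads \<pi> \<le> downloads \<pi>\<^sub>f"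
      and VarSp: "VarSp \<pi> \<le> 2 * nat \<lfloor>?b\<rfloor>"
      using resolution_refutation_of_projection[OF assms(1-4) F fin ref] by blast
    \<comment> \<open>\<open>nat\<close> sends negative numbers to 0, hence the use of
      \<open>0 \<le> ?b\<close>.\<close>
    have "real (nat \<lfloor>?b\<rfloor>) \<le> ?b"
      using \<open>0 \<le> ?b\<close> of_nat_floor by blast
    moreover have "real (VarSp \<pi>) \<le> 2 * real (nat \<lfloor>?b\<rfloor>)"
      using VarSp by linarith
    ultimately have "real (VarSp \<pi>) \<le> 2 * ?b" by linarith
    then show ?thesis
      using \<pi> by (auto simp: mult.assoc)
  qed
  then show ?thesis by blast
qed

text \<open>For \<open>K = 0\<close> the exponent \<open>1 / real K\<close> is \<open>0\<close>, so the bound on \<open>t\<close> is a constant.\<close>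

lemma bigo_power_of_powr_inverse:
  fixes s :: "nat \<Rightarrow> real" and t v :: "nat \<Rightarrow> nat"
  assumes s: "\<And>n. 1 \<le> s n"
    and t: "(\<lambda>n. real (t n)) \<in> O(\<lambda>n. s n powr (1 / real K))"
    and v: "\<And>n. real (v n) \<le> c * real (max 1 (t n)) ^ K"
  shows "(\<lambda>n. real (v n)) \<in> O(s)"
proof -
  obtain b where b: "b > 0"
    "eventually (\<lambda>n. norm (real (t n)) \<le> b * norm (s n powr (1 / real K))) sequentially"
    using landau_o.bigE[OF t] by blast
  \<comment> \<open>\<open>c\<close> may be negative, hence its absolute value;
    \<open>max 1 b\<close> is the factor that dominates both arguments of
    \<open>max 1 (t n)\<close>.\<close>
  have "eventually (\<lambda>n. norm (real (v n)) \<le> (\<bar>c\<bar> * (max 1 b) ^ K) * norm (s n)) sequentially"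
    using b(2)
  proof eventually_elim
    case (elim n)
    have root: "1 \<le> s n powr (1 / real K)"
      using s[of n] by (simp add: ge_one_powr_ge_zero)
    have pow: "(s n powr (1 / real K)) ^ K \<le> s n"
    proof (cases "K = 0")
      case False
      then show ?thesis
        using s[of n] by (simp add: powr_power)
    qed (use s[of n] in simp)
    have "real (t n) \<le> b * s n powr (1 / real K)"
      using elim by simp
    also have "\<dots> \<le> max 1 b * s n powr (1 / real K)"
      by (intro mult_right_mono) auto
    \<comment> \<open>Since the root is at least 1, the right-hand side also bounds the 1 inside
      \<open>max\<close>.\<close>
    finally have "real (max 1 (t n)) \<le> max 1 b * s n powr (1 / real K)"
      using mult_mono[of 1 "max 1 b" 1 "s n powr (1 / real K)"] root by (simp add: of_nat_max)
    then have "real (max 1 (t n)) ^ K \<le> (max 1 b * s n powr (1 / real K)) ^ K"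
      by (intro power_mono) auto
    also have "\<dots> \<le> max 1 b ^ K * s n"
      using pow by (simp add: power_mult_distrib mult_left_mono)
    finally have *: "real (max 1 (t n)) ^ K \<le> max 1 b ^ K * s n" .
    have "real (v n) \<le> \<bar>c\<bar> * real (max 1 (t n)) ^ K"
      using v[of n] mult_right_mono[of c "\<bar>c\<bar>" "real (max 1 (t n)) ^ K"] abs_ge_self[of c]
        zero_le_power[of "real (max 1 (t n))" K] by linarith
    also have "\<dots> \<le> \<bar>c\<bar> * (max 1 b ^ K * s n)"
      using * by (intro mult_left_mono) auto
    finally show ?case
      using s[of n] by (simp add: mult.assoc)
  qed
  then show ?thesis by (rule bigoI)
qed

theorem theorem5p6:
  fixes P :: "('l, 'v \<times> 'd::finite) proof_system"
    and Sp :: "'l set \<Rightarrow> nat"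
    and f :: "('d \<Rightarrow> bool) \<Rightarrow> bool"
    and cf :: "bool \<Rightarrow> 'd clause set"
    and K :: nat
  assumes "sequential P"
    and "implicational P"
    and "nonconstant f"
    and "cnfs_for f cf"
    and "\<exists>proj :: 'l set \<Rightarrow> 'v clause set. f_projection P f cf proj \<and> space_respecting P Sp K proj"
  shows "(\<exists>c :: real. \<forall>F :: 'v clause set. is_cnf F \<longrightarrow> unsatisfiable F \<longrightarrow>
            (\<forall>\<pi>\<^sub>f. semantic_refutation P (cnf_subst cf F) \<pi>\<^sub>f \<longrightarrow>
               (\<exists>\<pi>. resolution_refutation F \<pi> \<and>
                    downloads \<pi> \<le> downloads \<pi>\<^sub>f \<and>
                    real (VarSp \<pi>) \<le> c * real (max 1 (proof_space Sp \<pi>\<^sub>f)) ^ K))) \<and>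
         (\<forall>(F :: nat \<Rightarrow> 'v clause set) (s :: nat \<Rightarrow> real) (L :: nat \<Rightarrow> real).
            (\<forall>n. is_cnf (F n) \<and> unsatisfiable (F n)) \<longrightarrow> (\<forall>n. s n \<ge> 1) \<longrightarrow>
            \<not> (\<exists>\<pi>. (\<forall>n. resolution_refutation (F n) (\<pi> n)) \<and>
                   (\<lambda>n. real (VarSp (\<pi> n))) \<in> O(s) \<and>
                   (\<lambda>n. real (downloads (\<pi> n))) \<in> O(L)) \<longrightarrow>
            \<not> (\<exists>\<pi>\<^sub>f. (\<forall>n. semantic_refutation P (cnf_subst cf (F n)) (\<pi>\<^sub>f n)) \<and>
                   (\<lambda>n. real (proof_length (\<pi>\<^sub>f n))) \<in> O(L) \<and>
                   (\<lambda>n. real (proof_space Sp (\<pi>\<^sub>f n))) \<in> O(\<lambda>n. s n powr (1 / real K))))"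
proof -
  obtain proj :: "'l set \<Rightarrow> 'v clause set" where
    proj: "f_projection P f cf proj" "space_respecting P Sp K proj"
    using assms(5) by blast
  obtain c :: real where c: "\<And>F \<pi>\<^sub>f. is_cnf F \<Longrightarrow> semantic_refutation P (cnf_subst cf F) \<pi>\<^sub>f \<Longrightarrow>
      \<exists>\<pi>. resolution_refutation F \<pi> \<and> downloads \<pi> \<le> downloads \<pi>\<^sub>f \<and>
          real (VarSp \<pi>) \<le> c * real (max 1 (proof_space Sp \<pi>\<^sub>f)) ^ K"
    using space_bounded_resolution_refutation[OF assms(1,2,4) proj] by blast
  \<comment> \<open>This is the contrapositive form of the second claim.\<close>
  have "\<exists>\<pi>. (\<forall>n. resolution_refutation (F n) (\<pi> n)) \<and>
            (\<lambda>n. real (VarSp (\<pi> n))) \<in> O(s) \<and> (\<lambda>n. real (downloads (\<pi> n))) \<in> O(L)"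
    if F: "\<And>n. is_cnf (F n)" and s: "\<And>n. s n \<ge> 1"
      and ref: "\<And>n. semantic_refutation P (cnf_subst cf (F n)) (\<pi>\<^sub>f n)"
      and len: "(\<lambda>n. real (proof_length (\<pi>\<^sub>f n))) \<in> O(L)"
      and space: "(\<lambda>n. real (proof_space Sp (\<pi>\<^sub>f n))) \<in> O(\<lambda>n. s n powr (1 / real K))"
    for F :: "nat \<Rightarrow> 'v clause set" and s L :: "nat \<Rightarrow> real" and \<pi>\<^sub>f
  proof -
    \<comment> \<open>One refutation is chosen for each \<open>n\<close>; as \<open>c\<close> does
      not depend on \<open>n\<close>, the asymptotic bounds are uniform.\<close>
    obtain \<pi> where \<pi>: "\<And>n. resolution_refutation (F n) (\<pi> n)"
      "\<And>n. downloads (\<pi> n) \<le> downloads (\<pi>\<^sub>f n)"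
      "\<And>n. real (VarSp (\<pi> n)) \<le> c * real (max 1 (proof_space Sp (\<pi>\<^sub>f n))) ^ K"
      using c[OF F ref] by metis
    have "(\<lambda>n. real (downloads (\<pi> n))) \<in> O(\<lambda>n. real (proof_length (\<pi>\<^sub>f n)))"
      using \<pi>(2)
      by (intro landau_o.big_mono always_eventually) (simp add: proof_length_def trans_le_add1 flip: of_nat_add)
    then have "(\<lambda>n. real (downloads (\<pi> n))) \<in> O(L)"
      using len by (rule landau_o.big_trans)
    moreover have "(\<lambda>n. real (VarSp (\<pi> n))) \<in> O(s)"
      using bigo_power_of_powr_inverse[OF s space \<pi>(3)] .
    ultimately show ?thesis
      using \<pi>(1) by blast
  qed
  then show ?thesis
    using c by blast
qed

end
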